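(* Let $\mathcal P$ be a finite locally geometric poset and $\mathcal Q$ a TM-ideal of $\mathcal P$ with $\operatorname{rk}(\mathcal Q)=\operatorname{rk}(\mathcal P)-1$, and let $a=|A(\mathcal P)\setminus A(\mathcal Q)|$. Then $\chi_{\mathcal P}(t)=\chi_{\mathcal Q}(t)\cdot(t-a)$. In particular, if $\mathcal P$ is strictly supersolvable via a chain of TM-ideals $\{\hat0\}=\mathcal Q_0\subset\mathcal Q_1\subset\cdots\subset\mathcal Q_n=\mathcal P$ (each $\mathcal Q_i$ a TM-ideal of $\mathcal Q_{i+1}$ with $\operatorname{rk}(\mathcal Q_i)=i$) and $a_i=|A(\mathcal Q_i)\setminus A(\mathcal Q_{i-1})|$, then $\chi_{\mathcal P}(t)=\prod_{i=1}^n(t-a_i)$.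
   Context: In a poset, $x\vee y$ is the set of minimal common upper bounds, $\bigvee I$ the set of minimal upper bounds of $I$. A geometric lattice is a chain-finite lattice in which $y$ covers $x$ iff $y=x\vee a$ for an atom $a\not\le x$; an element is modular if its complements form an antichain. A locally geometric poset is graded, bounded below (minimum $\hat0$, rank $\operatorname{rk}$), each $\mathcal P_{\le x}$ a geometric lattice; $A(\mathcal P)$ is its set of atoms, $\operatorname{rk}(\mathcal P)$ its maximal rank. An order ideal $\mathcal Q$ is pure if its maximal elements share rank $\operatorname{rk}(\mathcal Q)$, join-closed if $T\subseteq\mathcal Q\Rightarrow\bigvee T\subseteq\mathcal Q$. A TM-ideal of $\mathcal P$ is a pure join-closed order ideal $\mathcal Q$ such that (TM1) $|a\vee y|=1$ whenever $y\in\mathcal Q$ and $a\in A(\mathcal P)\setminus A(\mathcal Q)$, and (TM2) for every maximal $x\in\mathcal P$ there is a maximal $y\in\mathcal Q$ modular in $\mathcal P_{\le x}$. Characteristic polynomial of a finite graded bounded-below poset $\mathcal P$: $\chi_{\mathcal P}(t)=\sum_{x\in\mathcal P}\mu_{\mathcal P}(x)t^{\operatorname{rk}(\mathcal P)-\operatorname{rk}(x)}$, where $\mu_{\mathcal P}(\hat0)=1$ and $\sum_{y\le x}\mu_{\mathcal P}(y)=0$ for $x\ne\hat0$ (applied to $\mathcal Q$ with its own rank $\operatorname{rk}(\mathcal Q)$). *)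

theory Defs
  imports Main "HOL-Computational_Algebra.Polynomial"
begin

text \<open>
  A poset is a set \<open>P\<close> of elements of an ordered type, with the induced order. The order of the
  type outside \<open>P\<close> plays no role: joins, meets, covers, atoms and ranks are all relative to \<open>P\<close>.
\<close>

definition minimal_elements :: "'a::order set \<Rightarrow> 'a set" where
  "minimal_elements P = {m \<in> P. \<not> (\<exists>x\<in>P. x < m)}"

definition maximal_elements :: "'a::order set \<Rightarrow> 'a set" where
  "maximal_elements P = {m \<in> P. \<not> (\<exists>x\<in>P. m < x)}"

definition joins :: "'a::order set \<Rightarrow> 'a set \<Rightarrow> 'a set" where
  "joins P I = minimal_elements {u \<in> P. \<forall>x\<in>I. x \<le> u}"

definition meets :: "'a::order set \<Rightarrow> 'a set \<Rightarrow> 'a set" where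
  "meets P I = maximal_elements {l \<in> P. \<forall>x\<in>I. l \<le> x}"

definition down :: "'a::order set \<Rightarrow> 'a \<Rightarrow> 'a set" where
  "down P x = {y \<in> P. y \<le> x}"

definition bounded_below :: "'a::order set \<Rightarrow> bool" where
  "bounded_below P \<longleftrightarrow> (\<exists>b\<in>P. \<forall>x\<in>P. b \<le> x)"

definition hat0 :: "'a::order set \<Rightarrow> 'a" where
  "hat0 P = (LEAST b. b \<in> P)"

definition hat1 :: "'a::order set \<Rightarrow> 'a" where
  "hat1 P = (GREATEST b. b \<in> P)"

definition covers :: "'a::order set \<Rightarrow> 'a \<Rightarrow> 'a \<Rightarrow> bool" where
  \<comment> \<open>\<open>y\<close> covers \<open>x\<close>\<close>
  "covers P y x \<longleftrightarrow> x \<in> P \<and> y \<in> P \<and> x < y \<and> \<not> (\<exists>z\<in>P. x < z \<and> z < y)"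

definition atoms :: "'a::order set \<Rightarrow> 'a set" where
  "atoms P = {a. covers P a (hat0 P)}"

definition antichain :: "'a::order set \<Rightarrow> bool" where
  "antichain S \<longleftrightarrow> (\<forall>x\<in>S. \<forall>y\<in>S. x \<le> y \<longrightarrow> x = y)"

definition chain_finite :: "'a::order set \<Rightarrow> bool" where
  "chain_finite P \<longleftrightarrow> (\<forall>C. pred_on.chain P (<) C \<longrightarrow> finite C)"

definition is_lattice :: "'a::order set \<Rightarrow> bool" where
  "is_lattice L \<longleftrightarrow> (\<forall>x\<in>L. \<forall>y\<in>L.
     (\<exists>s\<in>L. x \<le> s \<and> y \<le> s \<and> (\<forall>u\<in>L. x \<le> u \<and> y \<le> u \<longrightarrow> s \<le> u)) \<and>
     (\<exists>i\<in>L. i \<le> x \<and> i \<le> y \<and> (\<forall>l\<in>L. l \<le> x \<and> l \<le> y \<longrightarrow> l \<le> i)))"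

text \<open>In a lattice, \<^term>\<open>joins L {x, y}\<close> is the singleton of the least upper bound.\<close>

definition geometric_lattice :: "'a::order set \<Rightarrow> bool" where
  "geometric_lattice L \<longleftrightarrow> chain_finite L \<and> is_lattice L \<and>
     (\<forall>x\<in>L. \<forall>y\<in>L. covers L y x \<longleftrightarrow> (\<exists>a\<in>atoms L. \<not> a \<le> x \<and> joins L {x, a} = {y}))"

definition complements :: "'a::order set \<Rightarrow> 'a \<Rightarrow> 'a set" where
  "complements L x = {y \<in> L. joins L {x, y} = {hat1 L} \<and> meets L {x, y} = {hat0 L}}"

definition modular_element :: "'a::order set \<Rightarrow> 'a \<Rightarrow> bool" where
  "modular_element L x \<longleftrightarrow> x \<in> L \<and> antichain (complements L x)"

definition graded_poset :: "'a::order set \<Rightarrow> bool" where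
  "graded_poset P \<longleftrightarrow> (\<forall>x\<in>P. \<exists>k. \<forall>C.
     pred_on.maxchain (down P x) (<) C \<longrightarrow> finite C \<and> card C = k)"

text \<open>
  The length of a chain \<open>C\<close> is \<open>card C - 1\<close>. In a graded poset the maximum below is the common
  length of all maximal chains of \<^term>\<open>down P x\<close>.
\<close>

definition rk :: "'a::order set \<Rightarrow> 'a \<Rightarrow> nat" where
  "rk P x = Max {card C - 1 | C. pred_on.chain (down P x) (<) C}"

definition poset_rk :: "'a::order set \<Rightarrow> nat" where
  "poset_rk P = Max (rk P ` P)"

definition locally_geometric :: "'a::order set \<Rightarrow> bool" where
  "locally_geometric P \<longleftrightarrow>
     graded_poset P \<and> bounded_below P \<and> (\<forall>x\<in>P. geometric_lattice (down P x))"

definition order_ideal :: "'a::order set \<Rightarrow> 'a set \<Rightarrow> bool" where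
  "order_ideal P Q \<longleftrightarrow> Q \<subseteq> P \<and> (\<forall>x\<in>Q. \<forall>y\<in>P. y \<le> x \<longrightarrow> y \<in> Q)"

definition pure_poset :: "'a::order set \<Rightarrow> bool" where
  "pure_poset Q \<longleftrightarrow> (\<forall>x\<in>maximal_elements Q. rk Q x = poset_rk Q)"

definition join_closed :: "'a::order set \<Rightarrow> 'a set \<Rightarrow> bool" where
  "join_closed P Q \<longleftrightarrow> (\<forall>T. T \<subseteq> Q \<longrightarrow> joins P T \<subseteq> Q)"

definition TM_ideal :: "'a::order set \<Rightarrow> 'a set \<Rightarrow> bool" where
  \<comment> \<open>\<open>Q\<close> is a TM-ideal of \<open>P\<close>\<close>
  "TM_ideal P Q \<longleftrightarrow>
     order_ideal P Q \<and> pure_poset Q \<and> join_closed P Q \<and>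
     (\<forall>y\<in>Q. \<forall>a\<in>atoms P - atoms Q. card (joins P {a, y}) = 1) \<and>
     (\<forall>x\<in>maximal_elements P. \<exists>y\<in>maximal_elements Q. modular_element (down P x) y)"

definition strictly_supersolvable_via :: "'a::order set \<Rightarrow> nat \<Rightarrow> (nat \<Rightarrow> 'a set) \<Rightarrow> bool" where
  "strictly_supersolvable_via P n Q \<longleftrightarrow>
     Q 0 = {hat0 P} \<and> Q n = P \<and>
     (\<forall>i<n. Q i \<subset> Q (Suc i) \<and> TM_ideal (Q (Suc i)) (Q i)) \<and>
     (\<forall>i\<le>n. poset_rk (Q i) = i)"

text \<open>
  The guard is only needed for termination; the two lemmas after the definition are the
  usual defining equations.
\<close>

function moebius :: "'a::order set \<Rightarrow> 'a \<Rightarrow> int" where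
  "moebius P x =
     (if x = hat0 P then 1
      else if finite {y \<in> P. y < x} then - (\<Sum>y\<in>{y \<in> P. y < x}. moebius P y)
      else 0)"
  by auto
termination
proof (relation "measure (\<lambda>(P, x). card {y \<in> P. y < x})", goal_cases)
  case (2 P x y)
  then have "{z \<in> P. z < y} \<subset> {z \<in> P. z < x}"
    by (auto intro: less_trans)
  with 2 show ?case
    by (simp add: psubset_card_mono)
qed simp

declare moebius.simps [simp del]

lemma moebius_hat0: "moebius P (hat0 P) = 1"
  by (simp add: moebius.simps)

lemma sum_moebius_eq_0:
  assumes "finite P" "x \<in> P" "x \<noteq> hat0 P"
  shows "(\<Sum>y\<in>down P x. moebius P y) = 0"
proof -
  have "down P x = insert x {y \<in> P. y < x}"
    using assms(2) by (auto simp: down_def)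
  moreover have "finite {y \<in> P. y < x}"
    using assms(1) by simp
  ultimately show ?thesis
    using assms(3) by (simp add: moebius.simps[of P x])
qed

definition char_poly :: "'a::order set \<Rightarrow> int poly" where
  "char_poly P = (\<Sum>x\<in>P. monom (moebius P x) (poset_rk P - rk P x))"

end

theory Submission
  imports Defs
begin

text \<open>
  Call an atom of \<open>P\<close> outside \<open>Q\<close> new. Because \<open>Q\<close> is join-closed, each \<open>x \<in> P - Q\<close> has a
  largest element \<open>r x\<close> of \<open>Q\<close> below it, and (TM2) forces \<open>x\<close> to cover \<open>r x\<close>. By (TM1), for every new
  atom \<open>a\<close> the map \<open>y \<mapsto> a \<or> y\<close> is a bijection from \<open>Q\<close> onto the elements above \<open>a\<close>, with inverse \<open>r\<close>.
  Summing over these bijections below \<open>x\<close> shows that \<open>- n x * \<mu> (r x)\<close>, with \<open>n x\<close> the number of new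
  atoms below \<open>x\<close>, satisfies the recursion of \<open>\<mu> x\<close>. Summing over all of \<open>P\<close> then gives the factor
  \<open>t - a\<close>.
\<close>

section \<open>Minimum, covers, atoms and rank in an order ideal\<close>

lemma hat0_eqI: "b \<in> P \<Longrightarrow> (\<And>x. x \<in> P \<Longrightarrow> b \<le> x) \<Longrightarrow> hat0 P = b"
  unfolding hat0_def by (rule Least_equality) auto

lemma hat1_down: "x \<in> P \<Longrightarrow> hat1 (down P x) = x"
  unfolding hat1_def by (rule Greatest_equality) (auto simp: down_def)

lemma
  assumes "bounded_below P"
  shows hat0_in: "hat0 P \<in> P" and hat0_le: "x \<in> P \<Longrightarrow> hat0 P \<le> x"
proof -
  obtain b where b: "b \<in> P" "\<And>x. x \<in> P \<Longrightarrow> b \<le> x"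
    using assms unfolding bounded_below_def by blast
  then have "hat0 P = b" by (rule hat0_eqI)
  with b show "hat0 P \<in> P" "x \<in> P \<Longrightarrow> hat0 P \<le> x" by auto
qed

lemma order_ideal_bounded_below:
  assumes "bounded_below P" "order_ideal P Q" "Q \<noteq> {}"
  shows "bounded_below Q" "hat0 Q = hat0 P"
proof -
  have sub: "Q \<subseteq> P" using assms(2) by (simp add: order_ideal_def)
  then have le: "\<And>x. x \<in> Q \<Longrightarrow> hat0 P \<le> x" using hat0_le[OF assms(1)] by blast
  moreover have "hat0 P \<in> Q"
    using assms(2,3) hat0_in[OF assms(1)] le unfolding order_ideal_def by blast
  ultimately have 1: "hat0 P \<in> Q" "\<And>x. x \<in> Q \<Longrightarrow> hat0 P \<le> x" by auto
  then show "bounded_below Q" unfolding bounded_below_def by blast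
  show "hat0 Q = hat0 P" using 1 by (rule hat0_eqI)
qed

lemma order_ideal_down: "x \<in> P \<Longrightarrow> order_ideal P (down P x)"
  by (auto simp: order_ideal_def down_def)

lemma down_order_ideal: "order_ideal P Q \<Longrightarrow> x \<in> Q \<Longrightarrow> down Q x = down P x"
  by (auto simp: order_ideal_def down_def)

lemma covers_order_ideal: "order_ideal P Q \<Longrightarrow> covers Q y x \<longleftrightarrow> covers P y x \<and> y \<in> Q"
  unfolding order_ideal_def covers_def by (auto simp: less_le)

lemma covers_unique: "covers P y x \<Longrightarrow> z \<in> P \<Longrightarrow> z \<le> y \<Longrightarrow> x < z \<Longrightarrow> z = y"
  unfolding covers_def using order.not_eq_order_implies_strict by blast

lemma atoms_order_ideal:
  assumes "bounded_below P" "order_ideal P Q" "Q \<noteq> {}"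
  shows "atoms Q = atoms P \<inter> Q"
  unfolding atoms_def
  using order_ideal_bounded_below(2)[OF assms] covers_order_ideal[OF assms(2)] by auto

lemma rk_order_ideal: "order_ideal P Q \<Longrightarrow> x \<in> Q \<Longrightarrow> rk Q x = rk P x"
  unfolding rk_def by (simp add: down_order_ideal)

lemma graded_order_ideal:
  assumes "order_ideal P Q" "graded_poset P" shows "graded_poset Q"
proof -
  have "Q \<subseteq> P" using assms(1) by (simp add: order_ideal_def)
  then show ?thesis
    using assms unfolding graded_poset_def by (auto simp: down_order_ideal)
qed

lemma locally_geometric_order_ideal:
  assumes "order_ideal P Q" "Q \<noteq> {}" "locally_geometric P" shows "locally_geometric Q"
proof -
  have "Q \<subseteq> P" using assms(1) by (simp add: order_ideal_def)
  then show ?thesis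
    using assms graded_order_ideal order_ideal_bounded_below(1)[of P Q]
    unfolding locally_geometric_def by (auto simp: down_order_ideal)
qed

section \<open>Rank as the length of a longest chain\<close>

lemma chain_insert_top:
  assumes "pred_on.chain (down P x) (<) C" "x < y" "x \<in> P" "y \<in> P"
  shows "pred_on.chain (down P y) (<) (insert y C)" "y \<notin> C"
proof -
  have C: "\<And>c. c \<in> C \<Longrightarrow> c \<in> P \<and> c < y"
    using assms unfolding pred_on.chain_def by (force simp: down_def)
  then show "pred_on.chain (down P y) (<) (insert y C)" "y \<notin> C"
    using assms unfolding pred_on.chain_def by (force simp: down_def)+
qed

lemma finite_chain_cards:
  assumes "finite P"
  shows "finite {card C - 1 | C. pred_on.chain (down P x) (<) C}"
proof -
  have "{card C - 1 | C. pred_on.chain (down P x) (<) C} \<subseteq> (\<lambda>C. card C - 1) ` Pow P"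
    unfolding pred_on.chain_def by (auto simp: down_def)
  then show ?thesis using assms by (meson finite_Pow_iff finite_imageI finite_subset)
qed

lemma chain_card_le_rk:
  assumes "finite P" "pred_on.chain (down P x) (<) C"
  shows "card C - 1 \<le> rk P x"
  unfolding rk_def using finite_chain_cards[OF assms(1)] assms(2) by (intro Max_ge) auto

lemma obtain_rk_chain:
  assumes "finite P" "x \<in> P"
  obtains C where "pred_on.chain (down P x) (<) C" "card C = Suc (rk P x)"
proof -
  let ?S = "{card C - 1 | C. pred_on.chain (down P x) (<) C}"
  have single: "pred_on.chain (down P x) (<) {x}"
    using assms(2) by (auto simp: pred_on.chain_def down_def)
  then have "rk P x \<in> ?S"
    unfolding rk_def using finite_chain_cards[OF assms(1)] by (intro Max_in) auto
  then obtain C where C: "pred_on.chain (down P x) (<) C" "rk P x = card C - 1" by blast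
  show ?thesis
  \<comment> \<open>With truncated subtraction the empty chain also yields the value 0. In that case
    the singleton \<open>{x}\<close> is the chain of the required cardinality.\<close>
  proof (cases "C = {}")
    case True
    with C single that show ?thesis by simp
  next
    case False
    have "finite C" using C(1) assms(1) unfolding pred_on.chain_def down_def
      by (auto intro: finite_subset)
    with False have "card C > 0" by auto
    with C that show ?thesis by simp
  qed
qed

lemma rk_strict_mono:
  assumes "finite P" "x \<in> P" "y \<in> P" "x < y"
  shows "rk P x < rk P y"
proof -
  obtain C where C: "pred_on.chain (down P x) (<) C" "card C = Suc (rk P x)"
    using obtain_rk_chain[OF assms(1,2)] .
  then have "finite C" using card.infinite by fastforce
  with chain_insert_top[OF C(1) assms(4,2,3)] C(2)
    chain_card_le_rk[OF assms(1), of y "insert y C"]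
  show ?thesis by simp
qed

lemma rk_le_poset_rk: "finite P \<Longrightarrow> x \<in> P \<Longrightarrow> rk P x \<le> poset_rk P"
  unfolding poset_rk_def by simp

text \<open>A chain of greatest length is also maximal under inclusion, so the common cardinality
  provided by gradedness is the one that \<open>rk\<close> measures.\<close>

lemma maxchain_card:
  assumes "finite P" "graded_poset P" "x \<in> P" "pred_on.maxchain (down P x) (<) C"
  shows "card C = Suc (rk P x)"
proof -
  obtain k where k: "\<And>C. pred_on.maxchain (down P x) (<) C \<Longrightarrow> card C = k"
    using assms(2,3) unfolding graded_poset_def by blast
  obtain D where D: "pred_on.chain (down P x) (<) D" "card D = Suc (rk P x)"
    using obtain_rk_chain[OF assms(1,3)] .
  have "pred_on.maxchain (down P x) (<) D"
  proof -
    have "\<not> pred_on.chain (down P x) (<) E" if "D \<subset> E" for E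
    proof
      assume E: "pred_on.chain (down P x) (<) E"
      then have "finite E" using assms(1) unfolding pred_on.chain_def down_def
        by (auto intro: finite_subset)
      with that have "card D < card E" by (simp add: psubset_card_mono)
      with chain_card_le_rk[OF assms(1) E] D(2) show False by simp
    qed
    with D show ?thesis unfolding pred_on.maxchain_def by blast
  qed
  with k assms(4) D(2) show ?thesis by metis
qed

text \<open>Put \<open>y\<close> on top of a longest chain \<open>C\<close> below \<open>x\<close>.
  The result is a maximal chain below \<open>y\<close>: a further element cannot lie below
  \<open>x\<close>, where \<open>C\<close> would already contain it, so it would lie strictly
  between \<open>x\<close> and \<open>y\<close>. Gradedness then makes the rank one less than its
  cardinality.\<close>

lemma rk_covers:
  assumes "finite P" "graded_poset P" "covers P y x"
  shows "rk P y = Suc (rk P x)"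
proof -
  have xy: "x \<in> P" "y \<in> P" "x < y" using assms(3) by (auto simp: covers_def)
  obtain C where C: "pred_on.chain (down P x) (<) C" "card C = Suc (rk P x)"
    using obtain_rk_chain[OF assms(1) xy(1)] .
  then have fin: "finite C" using card.infinite by fastforce
  \<comment> \<open>\<open>C\<close> has the greatest possible length, so it already contains every
    element of \<open>down P x\<close> comparable to all its members. In particular it contains
    \<open>x\<close>.\<close>
  have max: "z \<in> C" if "z \<in> down P x" "\<And>c. c \<in> C \<Longrightarrow> c = z \<or> c < z \<or> z < c" for z
  proof (rule ccontr)
    assume "z \<notin> C"
    moreover have "pred_on.chain (down P x) (<) (insert z C)"
      using C(1) that unfolding pred_on.chain_def by blast
    ultimately show False
      using chain_card_le_rk[OF assms(1), of x "insert z C"] C(2) fin by simp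
  qed
  have "x \<in> C"
    using C(1) xy(1) by (intro max) (auto simp: down_def pred_on.chain_def less_le)
  have "pred_on.maxchain (down P y) (<) (insert y C)"
    unfolding pred_on.maxchain_def
  proof (intro conjI notI)
    show "pred_on.chain (down P y) (<) (insert y C)"
      using chain_insert_top(1)[OF C(1) xy(3,1,2)] .
    assume "\<exists>S. pred_on.chain (down P y) (<) S \<and> insert y C \<subset> S"
    then obtain S z where S: "pred_on.chain (down P y) (<) S" "insert y C \<subseteq> S"
      and z: "z \<in> S" "z \<noteq> y" "z \<notin> C" by blast
    have cmp: "c = z \<or> c < z \<or> z < c" if "c \<in> S" for c
      using S(1) z(1) that unfolding pred_on.chain_def by blast
    have "z \<in> P" "z < y"
      using S(1) z unfolding pred_on.chain_def by (auto simp: down_def)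
    moreover have "\<not> z \<le> x"
      using max[of z] z(3) \<open>z \<in> P\<close> cmp S(2) by (auto simp: down_def)
    ultimately have "x < z" using cmp[of x] \<open>x \<in> C\<close> S(2) by (auto simp: less_le)
    with \<open>z \<in> P\<close> \<open>z < y\<close> assms(3) show False by (auto simp: covers_def)
  qed
  from maxchain_card[OF assms(1,2) xy(2) this] C(2) fin chain_insert_top(2)[OF C(1) xy(3,1,2)]
  show ?thesis by simp
qed

section \<open>The recursion that determines the Moebius function\<close>

lemma moebius_unique:
  fixes f :: "'a::order \<Rightarrow> int"
  assumes "finite P" "f (hat0 P) = 1"
    and "\<And>x. x \<in> P \<Longrightarrow> x \<noteq> hat0 P \<Longrightarrow> (\<Sum>y\<in>down P x. f y) = 0" and "x \<in> P"
  shows "f x = moebius P x"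
  using assms(4)
proof (induction "card (down P x)" arbitrary: x rule: less_induct)
  case less
  show ?case
  proof (cases "x = hat0 P")
    case True
    then show ?thesis by (simp add: moebius_hat0 assms(2))
  next
    case False
    have fin: "finite (down P z)" for z using assms(1) by (simp add: down_def)
    have x: "x \<in> down P x" using less.prems by (simp add: down_def)
    have "f y = moebius P y" if "y \<in> down P x - {x}" for y
    proof (rule less.hyps)
      have "down P y \<subseteq> down P x" "x \<notin> down P y" using that by (auto simp: down_def)
      then have "down P y \<subset> down P x" using x by blast
      then show "card (down P y) < card (down P x)" using fin psubset_card_mono by blast
      show "y \<in> P" using that by (simp add: down_def)
    qed
    \<comment> \<open>Both functions sum to 0 over \<open>down P x\<close> and agree, by induction,
      everywhere except possibly at \<open>x\<close>; so they agree at \<open>x\<close> as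
      well.\<close>
    then have "(\<Sum>y\<in>down P x - {x}. f y) = (\<Sum>y\<in>down P x - {x}. moebius P y)" by simp
    moreover have "(\<Sum>y\<in>down P x. f y) = (\<Sum>y\<in>down P x. moebius P y)"
      using assms(3)[OF less.prems False] sum_moebius_eq_0[OF assms(1) less.prems False] by simp
    ultimately show ?thesis by (simp add: sum.remove[OF fin x])
  qed
qed

lemma moebius_order_ideal:
  assumes "finite P" "bounded_below P" "order_ideal P Q" "x \<in> Q"
  shows "moebius Q x = moebius P x"
proof -
  have Q: "Q \<subseteq> P" "hat0 Q = hat0 P"
    using assms order_ideal_bounded_below(2)[of P Q] by (auto simp: order_ideal_def)
  have "finite Q" using Q(1) assms(1) finite_subset by blast
  then show ?thesis
  proof (rule moebius_unique[symmetric])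
    show "moebius P (hat0 Q) = 1" by (simp add: Q(2) moebius_hat0)
    show "(\<Sum>y\<in>down Q z. moebius P y) = 0" if "z \<in> Q" "z \<noteq> hat0 Q" for z
      using that Q sum_moebius_eq_0[OF assms(1), of z]
      by (auto simp: down_order_ideal[OF assms(3)])
  qed (rule assms(4))
qed

section \<open>Joins, meets and covers in finite posets and geometric lattices\<close>

lemma minimal_element_below:
  assumes "finite S" "u \<in> S"
  shows "\<exists>m\<in>minimal_elements S. m \<le> u"
  using finite_has_minimal2[OF assms] unfolding minimal_elements_def by (force simp: less_le)

lemma join_below:
  assumes "finite P" "u \<in> P" "\<And>x. x \<in> T \<Longrightarrow> x \<le> u"
  shows "\<exists>m\<in>joins P T. m \<le> u"
  unfolding joins_def using assms by (intro minimal_element_below) auto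

lemma joins_least:
  assumes "s \<in> L" "\<And>x. x \<in> T \<Longrightarrow> x \<le> s" "\<And>u. u \<in> L \<Longrightarrow> (\<And>x. x \<in> T \<Longrightarrow> x \<le> u) \<Longrightarrow> s \<le> u"
  shows "joins L T = {s}"
proof -
  have "m = s" if "m \<in> L" "\<forall>x\<in>T. x \<le> m" "\<not> (\<exists>u\<in>{u \<in> L. \<forall>x\<in>T. x \<le> u}. u < m)" for m
  proof (rule ccontr)
    assume "m \<noteq> s"
    with assms(3)[of m] that(1,2) have "s < m" by (simp add: less_le)
    with that(3) assms(1,2) show False by blast
  qed
  moreover have "\<not> u < s" if "u \<in> L" "\<forall>x\<in>T. x \<le> u" for u
    using assms(3)[of u] that by (simp add: leD)
  ultimately show ?thesis
    using assms(1,2) unfolding joins_def minimal_elements_def by blast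
qed

lemma meets_greatest:
  assumes "i \<in> L" "\<And>x. x \<in> T \<Longrightarrow> i \<le> x" "\<And>l. l \<in> L \<Longrightarrow> (\<And>x. x \<in> T \<Longrightarrow> l \<le> x) \<Longrightarrow> l \<le> i"
  shows "meets L T = {i}"
proof -
  have "m = i" if "m \<in> L" "\<forall>x\<in>T. m \<le> x" "\<not> (\<exists>l\<in>{l \<in> L. \<forall>x\<in>T. l \<le> x}. m < l)" for m
  proof (rule ccontr)
    assume "m \<noteq> i"
    with assms(3)[of m] that(1,2) have "m < i" by (simp add: less_le)
    with that(3) assms(1,2) show False by blast
  qed
  moreover have "\<not> i < l" if "l \<in> L" "\<forall>x\<in>T. l \<le> x" for l
    using assms(3)[of l] that by (simp add: leD)
  ultimately show ?thesis
    using assms(1,2) unfolding meets_def maximal_elements_def by blast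
qed

lemma covers_below:
  assumes "finite L" "w \<in> L" "x \<in> L" "w < x"
  shows "\<exists>z. covers L z w \<and> z \<le> x"
proof -
  obtain z where z: "z \<in> minimal_elements {u \<in> L. w < u}" "z \<le> x"
    using minimal_element_below[of "{u \<in> L. w < u}" x] assms by auto
  then have "covers L z w"
    unfolding minimal_elements_def covers_def using assms(2) by auto
  with z(2) show ?thesis by blast
qed

lemma geometric_bounds:
  assumes "geometric_lattice L" "x \<in> L" "y \<in> L"
  shows "\<exists>s\<in>L. x \<le> s \<and> y \<le> s \<and> (\<forall>u\<in>L. x \<le> u \<and> y \<le> u \<longrightarrow> s \<le> u)"
    and "\<exists>i\<in>L. i \<le> x \<and> i \<le> y \<and> (\<forall>l\<in>L. l \<le> x \<and> l \<le> y \<longrightarrow> l \<le> i)"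
  using assms unfolding geometric_lattice_def is_lattice_def by simp_all

lemma geometric_join:
  assumes "geometric_lattice L" "x \<in> L" "y \<in> L"
  obtains s where "s \<in> L" "x \<le> s" "y \<le> s" "\<forall>u. u \<in> L \<longrightarrow> x \<le> u \<longrightarrow> y \<le> u \<longrightarrow> s \<le> u"
    "joins L {x, y} = {s}"
proof -
  obtain s where s: "s \<in> L" "x \<le> s" "y \<le> s" "\<forall>u. u \<in> L \<longrightarrow> x \<le> u \<longrightarrow> y \<le> u \<longrightarrow> s \<le> u"
    using geometric_bounds(1)[OF assms] by blast
  moreover have "joins L {x, y} = {s}" using s by (intro joins_least) auto
  ultimately show ?thesis by (rule that)
qed

lemma geometric_meet:
  assumes "geometric_lattice L" "x \<in> L" "y \<in> L"
  obtains i where "i \<in> L" "i \<le> x" "i \<le> y" "\<forall>l. l \<in> L \<longrightarrow> l \<le> x \<longrightarrow> l \<le> y \<longrightarrow> l \<le> i"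
  using geometric_bounds(2)[OF assms] by blast

lemma geometric_coversI:
  assumes "geometric_lattice L" "x \<in> L" "a \<in> atoms L" "\<not> a \<le> x" "joins L {x, a} = {y}"
  shows "covers L y x"
proof -
  have "y \<in> L" using assms(5) unfolding joins_def minimal_elements_def by blast
  with assms show ?thesis unfolding geometric_lattice_def by blast
qed

lemma geometric_coversE:
  assumes "geometric_lattice L" "covers L y x"
  obtains a where "a \<in> atoms L" "\<not> a \<le> x" "joins L {x, a} = {y}"
proof -
  have "x \<in> L" "y \<in> L" using assms(2) by (auto simp: covers_def)
  then have "\<exists>a\<in>atoms L. \<not> a \<le> x \<and> joins L {x, a} = {y}"
    using assms unfolding geometric_lattice_def by simp
  with that show ?thesis by blast
qed

lemma joins_le: "joins L T = {s} \<Longrightarrow> x \<in> T \<Longrightarrow> x \<le> s"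
  unfolding joins_def minimal_elements_def by blast

text \<open>If \<open>x\<close> did not cover \<open>x \<and> y\<close>, two atoms below \<open>x\<close> that are independent over \<open>x \<and> y\<close> would
  span a line meeting \<open>y\<close> trivially, and that line and a point on it would be comparable complements
  of \<open>y\<close>.\<close>

lemma modular_coatom_covers_meet:
  assumes fin: "finite L" and geo: "geometric_lattice L" and bb: "bounded_below L"
    and top: "covers L (hat1 L) y" "\<And>u. u \<in> L \<Longrightarrow> u \<le> hat1 L"
    and mod: "modular_element L y"
    and x: "x \<in> L" "\<not> x \<le> y"
    and w: "w \<in> L" "w \<le> x" "w \<le> y" "\<And>l. l \<in> L \<Longrightarrow> l \<le> x \<Longrightarrow> l \<le> y \<Longrightarrow> l \<le> w"
  shows "covers L x w"
proof -
  have y: "y \<in> L" and t: "hat1 L \<in> L" using top(1) by (auto simp: covers_def)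
  have atom_in: "b \<in> L" "b \<noteq> hat0 L" if "b \<in> atoms L" for b
    using that by (auto simp: atoms_def covers_def)
  \<comment> \<open>Since \<open>hat1 L\<close> covers \<open>y\<close>, anything not below
    \<open>y\<close> joins with \<open>y\<close> to the top. A nonzero common lower bound would have
    an atom below it, so sharing no atom with \<open>y\<close> makes the meet trivial.\<close>
  have compl: "c \<in> complements L y"
    if c: "c \<in> L" "\<not> c \<le> y" "\<And>b. b \<in> atoms L \<Longrightarrow> b \<le> c \<Longrightarrow> \<not> b \<le> y" for c
  proof -
    have "joins L {y, c} = {hat1 L}"
    proof (rule joins_least)
      fix u assume u: "u \<in> L" "\<And>x. x \<in> {y, c} \<Longrightarrow> x \<le> u"
      then have "y < u" using c(2) by (auto simp: less_le)
      with u(1) top show "hat1 L \<le> u" unfolding covers_def by (auto simp: less_le)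
    qed (use t top(2) y c in auto)
    moreover have "meets L {y, c} = {hat0 L}"
    proof (rule meets_greatest)
      fix l assume l: "l \<in> L" "\<And>x. x \<in> {y, c} \<Longrightarrow> l \<le> x"
      show "l \<le> hat0 L"
      proof (rule ccontr)
        assume "\<not> l \<le> hat0 L"
        then have "hat0 L < l" using hat0_le[OF bb l(1)] by (auto simp: less_le)
        then obtain b where "covers L b (hat0 L)" "b \<le> l"
          using covers_below[OF fin hat0_in[OF bb] l(1)] by blast
        then show False using c(3)[of b] l(2) unfolding atoms_def by force
      qed
    qed (use hat0_in[OF bb] hat0_le[OF bb] y c in auto)
    ultimately show ?thesis using c(1) by (simp add: complements_def)
  qed
  have "w < x" using w(2,3) x(2) by (auto simp: less_le)
  then obtain z where z: "covers L z w" "z \<le> x" using covers_below[OF fin w(1) x(1)] by blast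
  obtain a where a: "a \<in> atoms L" "\<not> a \<le> w" "joins L {w, a} = {z}"
    using geometric_coversE[OF geo z(1)] .
  have az: "a \<le> z" using joins_le[OF a(3)] by simp
  have aL: "a \<in> L" "\<not> a \<le> y"
    using atom_in[OF a(1)] w(4)[of a] a(2) order_trans[OF az z(2)] by auto
  have zL: "z \<in> L" "w \<le> z" using z(1) by (auto simp: covers_def)
  have "z = x"
  proof (rule ccontr)
    assume "z \<noteq> x"
    then have "z < x" using z(2) by simp
    then obtain z' where z': "covers L z' z" "z' \<le> x"
      using covers_below[OF fin zL(1) x(1)] by blast
    obtain a' where a': "a' \<in> atoms L" "\<not> a' \<le> z" "joins L {z, a'} = {z'}"
      using geometric_coversE[OF geo z'(1)] .
    have a'x: "a' \<le> x" using joins_le[OF a'(3), of a'] z'(2) by auto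
    obtain s where s: "s \<in> L" "a \<le> s" "a' \<le> s"
      "\<forall>u. u \<in> L \<longrightarrow> a \<le> u \<longrightarrow> a' \<le> u \<longrightarrow> s \<le> u" "joins L {a, a'} = {s}"
      using geometric_join[OF geo aL(1) atom_in(1)[OF a'(1)]] .
    \<comment> \<open>The element \<open>s\<close> is the line spanned by \<open>a\<close> and
      \<open>a'\<close>. It lies strictly above the point \<open>a\<close>, so \<open>a\<close> and
      \<open>s\<close> violate the antichain condition once both are complements of
      \<open>y\<close>.\<close>
    have na: "\<not> a' \<le> a" using a'(2) az by auto
    have cov: "covers L s a" using geometric_coversI[OF geo aL(1) a'(1) na s(5)] .
    have sx: "s \<le> x" using s(4)[rule_format, OF x(1)] a'x az z(2) by auto
    have "a \<in> complements L y"
    proof (rule compl)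
      fix b assume b: "b \<in> atoms L" "b \<le> a"
      then have "b = a" using a(1) unfolding atoms_def covers_def by (auto simp: less_le)
      with aL show "\<not> b \<le> y" by simp
    qed (use aL in auto)
    moreover have "s \<in> complements L y"
    proof (rule compl)
      fix b assume b: "b \<in> atoms L" "b \<le> s"
      show "\<not> b \<le> y"
      proof
        \<comment> \<open>Being below both \<open>x\<close> and \<open>y\<close>, such an atom
          \<open>b\<close> lies below \<open>w\<close>, hence below \<open>z\<close>. The line
          through \<open>a\<close> and \<open>b\<close> is then contained in \<open>z\<close>; it
          also lies below \<open>s\<close> and covers \<open>a\<close>, as \<open>s\<close> does, so
          it equals \<open>s\<close>. This puts \<open>a'\<close> below \<open>z\<close>, a
          contradiction.\<close>
        assume bly: "b \<le> y"
        have bL: "b \<in> L" using atom_in(1)[OF b(1)] .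
        have bz: "b \<le> z" using w(4)[OF bL _ bly] b(2) sx zL(2) by (meson order_trans)
        have nb: "\<not> b \<le> a"
        proof
          assume "b \<le> a"
          then have "b = a"
            using a(1) b(1) unfolding atoms_def covers_def by (auto simp: less_le)
          with bly aL show False by simp
        qed
        obtain r where r: "r \<in> L" "a \<le> r" "b \<le> r"
          "\<forall>u. u \<in> L \<longrightarrow> a \<le> u \<longrightarrow> b \<le> u \<longrightarrow> r \<le> u" "joins L {a, b} = {r}"
          using geometric_join[OF geo aL(1) bL] .
        have "covers L r a" using geometric_coversI[OF geo aL(1) b(1) nb r(5)] .
        moreover have "r \<le> s" using r(4)[rule_format, OF s(1,2) b(2)] .
        ultimately have "r = s" using cov unfolding covers_def by (auto simp: less_le)
        moreover have "r \<le> z" using r(4)[rule_format, OF zL(1) az bz] .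
        ultimately show False using s(3) a'(2) by auto
      qed
    qed (use s aL in auto)
    ultimately have "a = s" using mod s(2) unfolding modular_element_def antichain_def by blast
    with s(3) na show False by simp
  qed
  with z(1) show ?thesis by simp
qed

text \<open>Join-closedness is used with \<open>T = {}\<close>: the joins of the empty set are the
  minimal elements of \<open>P\<close>, of which a finite nonempty poset has at least one.\<close>

lemma join_closed_nonempty:
  assumes "finite P" "P \<noteq> {}" "join_closed P Q" shows "Q \<noteq> {}"
proof -
  obtain u where "u \<in> P" using assms(2) by blast
  then have "joins P {} \<noteq> {}" using join_below[OF assms(1), of u "{}"] by blast
  then show ?thesis using assms(3) unfolding join_closed_def by blast
qed

section \<open>The retraction onto a TM-ideal of corank one and its inverses\<close>

locale corank_one_TM_ideal =
  fixes P Q :: "'a::order set"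
  assumes fin: "finite P" and lg: "locally_geometric P" and tm: "TM_ideal P Q"
    and corank: "poset_rk P = Suc (poset_rk Q)"
begin

definition new_atoms :: "'a set" where
  "new_atoms = atoms P - atoms Q"

text \<open>A meaningful value only outside \<open>Q\<close>: the largest element of \<open>Q\<close> below \<open>x\<close>.\<close>

definition retract :: "'a \<Rightarrow> 'a" where
  "retract x = (SOME y. y \<in> Q \<and> covers P x y \<and> (\<forall>q\<in>Q. q \<le> x \<longrightarrow> q \<le> y))"

text \<open>Meaningful when \<open>a\<close> is a new atom and \<open>y \<in> Q\<close>, where (TM1)
  makes the set of joins a singleton.\<close>

definition join :: "'a \<Rightarrow> 'a \<Rightarrow> 'a" where
  "join a y = the_elem (joins P {a, y})"

lemma bb: "bounded_below P" and graded: "graded_poset P"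
  and geo: "x \<in> P \<Longrightarrow> geometric_lattice (down P x)"
  using lg unfolding locally_geometric_def by auto

lemma ideal: "order_ideal P Q" and sub: "Q \<subseteq> P" and jc: "join_closed P Q"
  using tm unfolding TM_ideal_def order_ideal_def by auto

lemma ideal_down: "x \<in> Q \<Longrightarrow> y \<in> P \<Longrightarrow> y \<le> x \<Longrightarrow> y \<in> Q"
  using ideal unfolding order_ideal_def by blast

lemma finQ: "finite Q"
  using sub fin finite_subset by blast

lemma nonempty: "Q \<noteq> {}"
  using join_closed_nonempty[OF fin _ jc] hat0_in[OF bb] by blast

lemma hat0Q: "hat0 Q = hat0 P"
  using order_ideal_bounded_below(2)[OF bb ideal nonempty] .

lemma new_atoms_iff: "a \<in> new_atoms \<longleftrightarrow> a \<in> atoms P \<and> a \<notin> Q"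
  using atoms_order_ideal[OF bb ideal nonempty] by (auto simp: new_atoms_def)

lemma fin_new_atoms: "finite new_atoms"
proof -
  have "new_atoms \<subseteq> P" by (auto simp: new_atoms_iff atoms_def covers_def)
  then show ?thesis using fin finite_subset by blast
qed

lemma new_atom_le_notin: "a \<in> new_atoms \<Longrightarrow> a \<le> x \<Longrightarrow> x \<notin> Q"
  using ideal_down[of x a] by (auto simp: new_atoms_iff atoms_def covers_def)

text \<open>Take a maximal \<open>m\<close> above \<open>x\<close> and, by (TM2), a maximal
  \<open>y\<close> of \<open>Q\<close> modular in \<open>down P m\<close>. Then \<open>y\<close> is
  a modular coatom of that lattice and the largest element of \<open>Q\<close> below
  \<open>m\<close>. Hence the meet \<open>w\<close> of \<open>x\<close> and \<open>y\<close> is the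
  largest element of \<open>Q\<close> below \<open>x\<close>, and
  \<open>modular_coatom_covers_meet\<close> says that \<open>x\<close> covers it.\<close>

lemma retract_exists:
  assumes x: "x \<in> P" "x \<notin> Q"
  shows "\<exists>y. y \<in> Q \<and> covers P x y \<and> (\<forall>q\<in>Q. q \<le> x \<longrightarrow> q \<le> y)"
proof -
  obtain m where m: "m \<in> maximal_elements P" "x \<le> m"
    using finite_has_maximal2[OF fin x(1)] unfolding maximal_elements_def by (force simp: less_le)
  then have mP: "m \<in> P" by (simp add: maximal_elements_def)
  have mQ: "m \<notin> Q" using ideal_down x m(2) by blast
  obtain y where y: "y \<in> maximal_elements Q" "modular_element (down P m) y"
    using tm m(1) unfolding TM_ideal_def by blast
  let ?L = "down P m"
  note idL = order_ideal_down[OF mP]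
  have yQ: "y \<in> Q" "y \<in> P" using y(1) sub by (auto simp: maximal_elements_def)
  have yL: "y \<in> ?L" using y(2) by (simp add: modular_element_def)
  have ym: "y < m" using yL mQ yQ by (auto simp: down_def less_le)
  have rky: "rk P y = poset_rk Q"
    using tm y(1) rk_order_ideal[OF ideal yQ(1)] by (auto simp: TM_ideal_def pure_poset_def)
  \<comment> \<open>Purity gives \<open>y\<close> the rank of \<open>Q\<close>, one less than that
    of \<open>P\<close>. An element strictly between \<open>y\<close> and \<open>m\<close> would
    push the rank of \<open>m\<close> beyond that of \<open>P\<close>.\<close>
  have "covers P m y"
    unfolding covers_def
  proof (intro conjI notI)
    assume "\<exists>z\<in>P. y < z \<and> z < m"
    then obtain z where "z \<in> P" "y < z" "z < m" by blast
    then have "rk P y < rk P z" "rk P z < rk P m"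
      using rk_strict_mono[OF fin] yQ mP by auto
    with rky rk_le_poset_rk[OF fin mP] corank show False by simp
  qed (use yQ mP ym in auto)
  moreover have "m \<in> ?L" using mP by (simp add: down_def)
  ultimately have cov: "covers ?L (hat1 ?L) y"
    using covers_order_ideal[OF idL] hat1_down[OF mP] by simp
  \<comment> \<open>The common upper bound \<open>m\<close> guarantees that \<open>q\<close> and
    \<open>y\<close> have a join. It stays in \<open>Q\<close> by join-closedness and lies above the
    maximal element \<open>y\<close>, so it is \<open>y\<close> itself.\<close>
  have le_y: "q \<le> y" if q: "q \<in> Q" "q \<le> m" for q
  proof -
    obtain j where j: "j \<in> joins P {q, y}"
      using join_below[OF fin mP, of "{q, y}"] q(2) less_imp_le[OF ym] by blast
    have "{q, y} \<subseteq> Q" using q(1) yQ(1) by simp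
    then have "joins P {q, y} \<subseteq> Q" using jc unfolding join_closed_def by simp
    with j have "j \<in> Q" by (rule rev_subsetD)
    moreover have "q \<le> j" "y \<le> j" using j by (auto simp: joins_def minimal_elements_def)
    ultimately show ?thesis using y(1) unfolding maximal_elements_def
      by (cases "y = j") (auto simp: order.not_eq_order_implies_strict)
  qed
  have xL: "x \<in> ?L" using x m(2) by (simp add: down_def)
  obtain w where w: "w \<in> ?L" "w \<le> x" "w \<le> y"
    "\<forall>l. l \<in> ?L \<longrightarrow> l \<le> x \<longrightarrow> l \<le> y \<longrightarrow> l \<le> w"
    using geometric_meet[OF geo[OF mP] xL yL] .
  have "covers ?L x w"
  proof (rule modular_coatom_covers_meet[OF _ geo[OF mP] _ cov _ y(2) xL _ w(1-3) w(4)[rule_format]])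
    show "finite ?L" using fin by (simp add: down_def)
    show "bounded_below ?L" using order_ideal_bounded_below(1)[OF bb idL] xL by blast
    show "u \<le> hat1 ?L" if "u \<in> ?L" for u using that mP by (simp add: hat1_down) (simp add: down_def)
    show "\<not> x \<le> y" using ideal_down x yQ by blast
  qed
  then have "covers P x w" using covers_order_ideal[OF idL] by blast
  moreover have "w \<in> Q" using ideal_down[OF yQ(1) _ w(3)] w(1) by (simp add: down_def)
  moreover have "q \<le> w" if "q \<in> Q" "q \<le> x" for q
  proof (rule w(4)[rule_format])
    show "q \<in> ?L" using that sub m(2) by (auto simp: down_def)
    then show "q \<le> y" using le_y that(1) by (simp add: down_def)
  qed (rule that)
  ultimately show ?thesis by blast
qed

lemma retract:
  assumes "x \<in> P" "x \<notin> Q"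
  shows "retract x \<in> Q" "covers P x (retract x)" "\<And>q. q \<in> Q \<Longrightarrow> q \<le> x \<Longrightarrow> q \<le> retract x"
  using someI_ex[OF retract_exists[OF assms]] unfolding retract_def by blast+

lemma join:
  assumes "a \<in> new_atoms" "y \<in> Q"
  shows "joins P {a, y} = {join a y}" "join a y \<in> P" "a \<le> join a y" "y \<le> join a y"
    "\<And>u. u \<in> P \<Longrightarrow> a \<le> u \<Longrightarrow> y \<le> u \<Longrightarrow> join a y \<le> u"
proof -
  have "card (joins P {a, y}) = 1"
    using tm assms unfolding TM_ideal_def new_atoms_def by blast
  then show eq: "joins P {a, y} = {join a y}"
    unfolding join_def by (metis card_1_singletonE the_elem_eq)
  then have "join a y \<in> joins P {a, y}" by simp
  then show "join a y \<in> P" "a \<le> join a y" "y \<le> join a y"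
    by (auto simp: joins_def minimal_elements_def)
  show "join a y \<le> u" if "u \<in> P" "a \<le> u" "y \<le> u" for u
    using join_below[OF fin that(1), of "{a, y}"] that eq by auto
qed

text \<open>Inside the geometric lattice \<open>down P (join a y)\<close> the element
  \<open>a\<close> is an atom not below \<open>y\<close>, so the covering axiom applies; covers in
  an order ideal are covers in \<open>P\<close>.\<close>

lemma join_covers:
  assumes "a \<in> new_atoms" "y \<in> Q"
  shows "covers P (join a y) y"
proof -
  let ?j = "join a y"
  note j = join[OF assms]
  let ?L = "down P ?j"
  note idL = order_ideal_down[OF j(2)]
  have jL: "?j \<in> ?L" using j by (simp add: down_def)
  have "covers ?L ?j y"
  proof (rule geometric_coversI[OF geo[OF j(2)]])
    show "y \<in> ?L" using j assms(2) sub by (auto simp: down_def)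
    show "a \<in> atoms ?L"
      using atoms_order_ideal[OF bb idL] assms(1) j jL
      by (auto simp: new_atoms_iff down_def atoms_def covers_def)
    show "\<not> a \<le> y" using new_atom_le_notin assms by blast
    show "joins ?L {y, a} = {?j}"
      using j jL by (intro joins_least) (auto simp: down_def)
  qed
  then show ?thesis using covers_order_ideal[OF idL] by blast
qed

text \<open>The retraction of \<open>join a y\<close> lies above \<open>y\<close> and strictly below
  \<open>join a y\<close>. Since \<open>join a y\<close> covers \<open>y\<close>, nothing other than
  \<open>y\<close> fits there.\<close>

lemma retract_join:
  assumes "a \<in> new_atoms" "y \<in> Q"
  shows "retract (join a y) = y"
proof -
  note j = join[OF assms]
  have "join a y \<notin> Q" using new_atom_le_notin[OF assms(1) j(3)] .
  note r = retract[OF j(2) this]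
  have "y \<le> retract (join a y)" using r(3) assms(2) j(4) by blast
  then show ?thesis
    using join_covers[OF assms] r(2) unfolding covers_def by (auto simp: less_le)
qed

text \<open>The join lies strictly above \<open>retract x\<close> and not above \<open>x\<close>'s
  level: it is at most \<open>x\<close>, because \<open>x\<close> bounds both \<open>a\<close> and
  \<open>retract x\<close>. As \<open>x\<close> covers \<open>retract x\<close>, it must be
  \<open>x\<close>.\<close>

lemma join_retract:
  assumes "a \<in> new_atoms" "x \<in> P" "a \<le> x"
  shows "join a (retract x) = x"
proof -
  note r = retract[OF assms(2) new_atom_le_notin[OF assms(1,3)]]
  note j = join[OF assms(1) r(1)]
  have "retract x \<le> x" using r(2) by (simp add: covers_def less_imp_le)
  with assms have "join a (retract x) \<le> x" by (intro j(5))
  moreover have "retract x < join a (retract x)"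
    using join_covers[OF assms(1) r(1)] by (simp add: covers_def)
  ultimately show ?thesis by (rule covers_unique[OF r(2) j(2)])
qed

section \<open>Summation along the bijections, the Moebius function and the characteristic
  polynomial\<close>

lemma sum_retract:
  assumes "a \<in> new_atoms"
  shows "(\<Sum>x\<in>{x \<in> P. a \<le> x}. g (retract x)) = (\<Sum>y\<in>Q. g y)"
proof (rule sum.reindex_bij_witness[where i = "join a" and j = retract])
  show "join a y \<in> {x \<in> P. a \<le> x}" "retract (join a y) = y" if "y \<in> Q" for y
    using join(2,3)[OF assms that] retract_join[OF assms that] by auto
  show "retract x \<in> Q" "join a (retract x) = x" if "x \<in> {x \<in> P. a \<le> x}" for x
    using that retract(1)[OF _ new_atom_le_notin[OF assms]] join_retract[OF assms] by auto
qed simp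

text \<open>The bijection restricts to lower intervals: elements of \<open>Q\<close> below
  \<open>x\<close> are below \<open>retract x\<close>, and joining them with
  \<open>a \<le> x\<close> does not leave \<open>down P x\<close>.\<close>

lemma sum_retract_down:
  assumes "a \<in> new_atoms" "x \<in> P" "a \<le> x"
  shows "(\<Sum>z\<in>{z \<in> down P x. a \<le> z}. g (retract z)) = (\<Sum>y\<in>down P (retract x). g y)"
proof (rule sum.reindex_bij_witness[where i = "join a" and j = retract])
  note r = retract[OF assms(2) new_atom_le_notin[OF assms(1,3)]]
  have rx: "retract x \<le> x" using r(2) by (simp add: covers_def less_imp_le)
  show "retract z \<in> down P (retract x)" if "z \<in> {z \<in> down P x. a \<le> z}" for z
  proof -
    have z: "z \<in> P" "z \<le> x" "a \<le> z" using that by (auto simp: down_def)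
    note s = retract[OF z(1) new_atom_le_notin[OF assms(1) z(3)]]
    have "retract z \<le> x" using s(2) z(2) by (auto simp: covers_def)
    then show ?thesis using r(3)[OF s(1)] s(1) sub by (auto simp: down_def)
  qed
  show "join a y \<in> {z \<in> down P x. a \<le> z}" "retract (join a y) = y"
    if "y \<in> down P (retract x)" for y
  proof -
    have y: "y \<in> Q" "y \<le> x"
      using that ideal_down[OF r(1)] rx by (auto simp: down_def)
    show "join a y \<in> {z \<in> down P x. a \<le> z}"
      using join(2,3)[OF assms(1) y(1)] join(5)[OF assms(1) y(1) assms(2,3) y(2)]
      by (simp add: down_def)
    show "retract (join a y) = y" using retract_join[OF assms(1) y(1)] .
  qed
qed (use join_retract[OF assms(1)] in \<open>auto simp: down_def\<close>)

text \<open>Both sides run over the pairs of a new atom \<open>a\<close> and some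
  \<open>z \<in> S\<close> above it; such a \<open>z\<close> is automatically outside
  \<open>Q\<close>. It serves with \<open>S = down P x\<close> over the integers and with
  \<open>S = P\<close> over polynomials.\<close>

lemma double_count_new_atoms:
  fixes g :: "'a \<Rightarrow> 'b::comm_semiring_1"
  assumes "S \<subseteq> P"
  shows "(\<Sum>z\<in>S - Q. of_nat (card {a \<in> new_atoms. a \<le> z}) * g z) =
    (\<Sum>a\<in>new_atoms. \<Sum>z\<in>{z \<in> S. a \<le> z}. g z)"
proof -
  have fS: "finite S" using assms fin finite_subset by blast
  have "(\<Sum>z\<in>S - Q. of_nat (card {a \<in> new_atoms. a \<le> z}) * g z) =
      (\<Sum>z\<in>S - Q. \<Sum>a\<in>{a \<in> new_atoms. a \<le> z}. g z)"
    by simp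
  also have "\<dots> = (\<Sum>a\<in>new_atoms. \<Sum>z\<in>{z \<in> S - Q. a \<le> z}. g z)"
    using fS fin_new_atoms by (intro sum.swap_restrict) auto
  also have "\<dots> = (\<Sum>a\<in>new_atoms. \<Sum>z\<in>{z \<in> S. a \<le> z}. g z)"
    using new_atom_le_notin by (intro sum.cong) auto
  finally show ?thesis .
qed

text \<open>The formula is extended by the Moebius values on \<open>Q\<close> to a function
  \<open>f\<close>, which is identified by \<open>moebius_unique\<close>. For \<open>x\<close>
  outside \<open>Q\<close>, let \<open>m\<close> be the Moebius sum below \<open>retract x\<close>
  and \<open>n\<close> the number of new atoms below \<open>x\<close>. Elements of \<open>Q\<close>
  below \<open>x\<close> contribute \<open>m\<close> and the others \<open>- n * m\<close>, so it
  remains to see that \<open>m - n * m\<close> vanishes.\<close>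

lemma moebius_new:
  assumes "x \<in> P" "x \<notin> Q"
  shows "moebius P x = - int (card {a \<in> new_atoms. a \<le> x}) * moebius P (retract x)"
proof -
  define f where "f x = (if x \<in> Q then moebius P x
    else - int (card {a \<in> new_atoms. a \<le> x}) * moebius P (retract x))" for x
  have "f x = moebius P x"
  proof (rule moebius_unique[OF fin _ _ assms(1)])
    show "f (hat0 P) = 1"
      using hat0Q hat0_in[OF order_ideal_bounded_below(1)[OF bb ideal nonempty]]
      by (simp add: f_def moebius_hat0)
    fix x assume x: "x \<in> P" "x \<noteq> hat0 P"
    show "(\<Sum>y\<in>down P x. f y) = 0"
    proof (cases "x \<in> Q")
      case True
      then have "(\<Sum>y\<in>down P x. f y) = (\<Sum>y\<in>down P x. moebius P y)"
        using ideal_down by (intro sum.cong) (auto simp: f_def down_def)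
      then show ?thesis using sum_moebius_eq_0[OF fin x] by simp
    next
      case False
      note r = retract[OF x(1) False]
      have rx: "retract x \<le> x" "retract x \<in> P" using r(2) by (auto simp: covers_def)
      let ?n = "int (card {a \<in> new_atoms. a \<le> x})"
      let ?m = "\<Sum>y\<in>down P (retract x). moebius P y"
      have fd: "finite (down P x)" using fin by (simp add: down_def)
      have "down P x \<inter> Q = down P (retract x)"
        using r(1,3) rx sub ideal_down[OF r(1)] by (auto simp: down_def)
      then have old: "(\<Sum>y\<in>down P x \<inter> Q. f y) = ?m"
        by (intro sum.cong) (auto simp: f_def)
      have "(\<Sum>z\<in>down P x - Q. f z) =
          - (\<Sum>z\<in>down P x - Q. int (card {a \<in> new_atoms. a \<le> z}) * moebius P (retract z))"
        by (simp add: f_def sum_negf)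
      also have "\<dots> = - (\<Sum>a\<in>new_atoms. \<Sum>z\<in>{z \<in> down P x. a \<le> z}. moebius P (retract z))"
        by (subst double_count_new_atoms) (auto simp: down_def)
      \<comment> \<open>A new atom not below \<open>x\<close> has an empty inner sum. Each of the
        remaining ones contributes \<open>?m\<close> by \<open>sum_retract_down\<close>.\<close>
      also have "(\<Sum>a\<in>new_atoms. \<Sum>z\<in>{z \<in> down P x. a \<le> z}. moebius P (retract z)) =
          (\<Sum>a\<in>{a \<in> new_atoms. a \<le> x}. \<Sum>z\<in>{z \<in> down P x. a \<le> z}. moebius P (retract z))"
      proof (rule sum.mono_neutral_right[OF fin_new_atoms])
        show "\<forall>a\<in>new_atoms - {a \<in> new_atoms. a \<le> x}.
            (\<Sum>z\<in>{z \<in> down P x. a \<le> z}. moebius P (retract z)) = 0"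
        proof
          fix a assume "a \<in> new_atoms - {a \<in> new_atoms. a \<le> x}"
          then have "{z \<in> down P x. a \<le> z} = {}" by (auto simp: down_def)
          then show "(\<Sum>z\<in>{z \<in> down P x. a \<le> z}. moebius P (retract z)) = 0"
            by (simp only: sum.empty)
        qed
      qed auto
      also have "\<dots> = (\<Sum>a\<in>{a \<in> new_atoms. a \<le> x}. ?m)"
        by (rule sum.cong) (use sum_retract_down x in auto)
      finally have new: "(\<Sum>z\<in>down P x - Q. f z) = - ?n * ?m" by simp
      have tot: "(\<Sum>y\<in>down P x. f y) = ?m - ?n * ?m"
        using sum.Int_Diff[OF fd, of f Q] old new by simp
      show ?thesis
      \<comment> \<open>If \<open>retract x\<close> is the minimum, then \<open>x\<close> is itself
        a new atom and the only one below \<open>x\<close>, so \<open>?n = 1\<close>. Otherwise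
        \<open>?m = 0\<close> by the recursion at \<open>retract x\<close>.\<close>
      proof (cases "retract x = hat0 P")
        case True
        then have xa: "x \<in> new_atoms"
          using r(2) False by (auto simp: new_atoms_iff atoms_def)
        have "a = x" if "a \<in> new_atoms" "a \<le> x" for a
          using that xa unfolding new_atoms_iff atoms_def covers_def by (auto simp: less_le)
        then have "{a \<in> new_atoms. a \<le> x} = {x}" using xa by auto
        with tot show ?thesis by simp
      next
        case False
        then show ?thesis using tot sum_moebius_eq_0[OF fin rx(2)] by simp
      qed
    qed
  qed
  with assms show ?thesis by (simp add: f_def)
qed

lemma char_poly_eq: "char_poly P = char_poly Q * [:- int (card new_atoms), 1:]"
proof -
  define R where "R = poset_rk Q"
  \<comment> \<open>On \<open>Q\<close> this is the summand of \<open>char_poly Q\<close>, written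
    with the Moebius function and rank of \<open>P\<close>, which agree there with those of
    \<open>Q\<close>.\<close>
  define h where "h y = monom (moebius P y) (R - rk P y)" for y
  \<comment> \<open>The ambient rank grows by one while the rank of \<open>y\<close> stays, hence
    one extra factor t. The bound on \<open>rk P y\<close> keeps the truncated subtraction
    exact.\<close>
  have old: "monom (moebius P y) (Suc R - rk P y) = h y * monom 1 1" if "y \<in> Q" for y
    using rk_le_poset_rk[OF finQ that] rk_order_ideal[OF ideal that]
    by (simp add: h_def R_def mult_monom Suc_diff_le)
  \<comment> \<open>Since \<open>x\<close> covers \<open>retract x\<close>, its rank exceeds that of
    \<open>retract x\<close> by one, which offsets the growth of the ambient rank: the exponent is
    that of \<open>h (retract x)\<close>.\<close>
  have new: "monom (moebius P x) (Suc R - rk P x) =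
      - (of_nat (card {a \<in> new_atoms. a \<le> x}) * h (retract x))" if "x \<in> P - Q" for x
  proof -
    have x: "x \<in> P" "x \<notin> Q" using that by auto
    show ?thesis
      using rk_covers[OF fin graded retract(2)[OF x]]
      by (simp add: moebius_new[OF x] h_def of_nat_poly smult_monom flip: minus_monom)
  qed
  have Q: "char_poly Q = (\<Sum>y\<in>Q. h y)"
    unfolding char_poly_def
    by (intro sum.cong)
      (auto simp: h_def R_def rk_order_ideal[OF ideal] moebius_order_ideal[OF fin bb ideal])
  have "char_poly P = (\<Sum>x\<in>P. monom (moebius P x) (Suc R - rk P x))"
    by (simp add: char_poly_def corank R_def)
  also have "\<dots> = (\<Sum>x\<in>P - Q. monom (moebius P x) (Suc R - rk P x)) +
      (\<Sum>x\<in>Q. monom (moebius P x) (Suc R - rk P x))"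
    by (rule sum.subset_diff[OF sub fin])
  also have "(\<Sum>x\<in>Q. monom (moebius P x) (Suc R - rk P x)) = char_poly Q * monom 1 1"
    by (simp add: Q sum_distrib_right old)
  also have "(\<Sum>x\<in>P - Q. monom (moebius P x) (Suc R - rk P x)) =
      - (\<Sum>x\<in>P - Q. of_nat (card {a \<in> new_atoms. a \<le> x}) * h (retract x))"
    by (simp add: new sum_negf)
  also have "\<dots> = - (\<Sum>a\<in>new_atoms. \<Sum>x\<in>{x \<in> P. a \<le> x}. h (retract x))"
    by (simp add: double_count_new_atoms)
  \<comment> \<open>By \<open>sum_retract\<close>, every new atom contributes one full copy of
    \<open>char_poly Q\<close>.\<close>
  also have "\<dots> = - (of_nat (card new_atoms) * char_poly Q)"
    by (simp add: sum_retract Q)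
  also have "- (of_nat (card new_atoms) * char_poly Q) + char_poly Q * monom 1 1 =
      char_poly Q * (monom 1 1 - of_nat (card new_atoms))"
    by (simp add: algebra_simps)
  also have "monom 1 1 - of_nat (card new_atoms) = [:- int (card new_atoms), 1:]"
    by (simp add: monom_altdef of_nat_poly)
  finally show ?thesis .
qed

end

section \<open>The factorization along a chain of TM-ideals\<close>

lemma char_poly_TM_ideal:
  fixes P Q :: "'a::order set"
  assumes "finite P" "locally_geometric P" "TM_ideal P Q" "poset_rk P = Suc (poset_rk Q)"
  shows "char_poly P = char_poly Q * [:- int (card (atoms P - atoms Q)), 1:]"
proof -
  interpret corank_one_TM_ideal P Q using assms by unfold_locales
  show ?thesis using char_poly_eq by (simp add: new_atoms_def)
qed

text \<open>Passes the standing assumptions on to the ideal, so that the corank-one factorization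
  can be repeated down a chain.\<close>

lemma TM_ideal_locally_geometric:
  assumes "finite P" "locally_geometric P" "TM_ideal P Q"
  shows "finite Q" "locally_geometric Q"
proof -
  have Q: "order_ideal P Q" "join_closed P Q" using assms(3) by (auto simp: TM_ideal_def)
  show "finite Q" using assms(1) Q(1) finite_subset by (auto simp: order_ideal_def)
  have "P \<noteq> {}" using assms(2) by (auto simp: locally_geometric_def bounded_below_def)
  then have "Q \<noteq> {}" using join_closed_nonempty[OF assms(1)] Q(2) by blast
  then show "locally_geometric Q" using locally_geometric_order_ideal Q(1) assms(2) by blast
qed

lemma char_poly_singleton: "char_poly {x} = 1"
proof -
  have "hat0 {x} = x" by (rule hat0_eqI) auto
  then have "moebius {x} x = 1" using moebius_hat0[of "{x}"] by simp
  then show ?thesis by (simp add: char_poly_def poset_rk_def)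
qed

theorem theorem5p10:
  fixes P :: "'a::order set"
  assumes "finite P" and "locally_geometric P"
  shows "(\<forall>Q. TM_ideal P Q \<and> int (poset_rk Q) = int (poset_rk P) - 1 \<longrightarrow>
            char_poly P = char_poly Q * [:- int (card (atoms P - atoms Q)), 1:]) \<and>
         (\<forall>n Q. strictly_supersolvable_via P n Q \<longrightarrow>
            char_poly P = (\<Prod>i=1..n. [:- int (card (atoms (Q i) - atoms (Q (i - 1)))), 1:]))"
proof (intro conjI allI impI)
  fix Q assume "TM_ideal P Q \<and> int (poset_rk Q) = int (poset_rk P) - 1"
  \<comment> \<open>Over the integers the rank condition says exactly
    \<open>poset_rk P = Suc (poset_rk Q)\<close>, with no truncation at 0.\<close>
  then show "char_poly P = char_poly Q * [:- int (card (atoms P - atoms Q)), 1:]"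
    using assms by (intro char_poly_TM_ideal) auto
next
  fix n and Q :: "nat \<Rightarrow> 'a set"
  assume "strictly_supersolvable_via P n Q"
  then have Q: "Q 0 = {hat0 P}" "Q n = P" "\<And>i. i < n \<Longrightarrow> TM_ideal (Q (Suc i)) (Q i)"
    "\<And>i. i \<le> n \<Longrightarrow> poset_rk (Q i) = i"
    unfolding strictly_supersolvable_via_def by auto
  \<comment> \<open>The hypotheses are given at the top, \<open>Q n = P\<close>, and descend from
    each member of the chain to the ideal below it; hence the downward induction.\<close>
  have lg: "finite (Q i) \<and> locally_geometric (Q i)" if "i \<le> n" for i
    using that
  proof (induction rule: inc_induct)
    case base
    then show ?case using assms Q(2) by simp
  next
    case (step i)
    then show ?case using TM_ideal_locally_geometric Q(3) by blast
  qed
  \<comment> \<open>The product is built upwards instead, from the one-element poset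
    \<open>Q 0\<close>, whose characteristic polynomial is the empty product.\<close>
  have "char_poly (Q k) = (\<Prod>i=1..k. [:- int (card (atoms (Q i) - atoms (Q (i - 1)))), 1:])"
    if "k \<le> n" for k
    using that
  proof (induction k)
    case 0
    then show ?case by (simp add: Q(1) char_poly_singleton)
  next
    case (Suc k)
    then have "char_poly (Q (Suc k)) =
        char_poly (Q k) * [:- int (card (atoms (Q (Suc k)) - atoms (Q k))), 1:]"
      using lg Q(3,4) by (intro char_poly_TM_ideal) auto
    with Suc show ?case by (simp add: prod.nat_ivl_Suc')
  qed
  then show "char_poly P = (\<Prod>i=1..n. [:- int (card (atoms (Q i) - atoms (Q (i - 1)))), 1:])"
    using Q(2) by auto
qed

end
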